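(* Let $p,q,r\geq 1$ be integers and let $$M_{p,q,r}=\sum_{i=1}^p\sum_{j=1}^q\sum_{k=1}^r e_{i,j}\otimes e_{j,k}\otimes e_{k,i}\in\mathbb{C}^{p\times q}\otimes\mathbb{C}^{q\times r}\otimes\mathbb{C}^{r\times p}.$$ This decomposition (with $pqr$ summands, all with coefficient $1$) is a diagonal singular value decomposition of $M_{p,q,r}$. In particular, the singular values of $M_{p,q,r}$ are $\underbrace{1,1,\dots,1}_{pqr}$.
   Context: $\mathbb{C}^{a\times b}$ is the space of complex $a\times b$ matrices with Hermitian form $\langle A,B\rangle=\operatorname{trace}(AB^\star)$; $e_{i,j}$ is the matrix with a $1$ in position $(i,j)$ and zeroes elsewhere. For a tensor product $V=V^{(1)}\otimes\cdots\otimes V^{(d)}$ of finite dimensional Hilbert spaces (with the induced Hermitian form), a pure tensor is an element of the form $v^{(1)}\otimes\cdots\otimes v^{(d)}$ with $v^{(e)}\in V^{(e)}$. For a tuple $\mathbf{S}=(S_1,\dots,S_m)$ of tensors in $V$ and $\alpha>0$, $[\mathbf{S}]_\alpha$ is the maximum of $\big(\sum_{i=1}^m|\langle S_i,u\rangle|^\alpha\big)^{1/\alpha}$ over all pure tensors $u\in V$ of unit length. For real $t\geq 1$, a tuple $\mathbf{S}$ of tensors of unit length is called $t$-orthogonal if $[\mathbf{S}]_{2/t}=1$. A diagonal singular value decomposition of $T\in V$ is a decomposition $T=\sum_{i=1}^m\sigma_iv_i$ where $\sigma_1\geq\cdots\geq\sigma_m>0$ are real and $(v_1,\dots,v_m)$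 is a $2$-orthogonal tuple of pure tensors of unit length; $\sigma_1,\dots,\sigma_m$ are called the singular values (they are uniquely determined by $T$). *)

theory Defs
  imports "Jordan_Normal_Form.Schur_Decomposition"
begin

text \<open>
  The tensor product of the matrix spaces given by a list of formats
  \<open>ds = [(a\<^sub>1,b\<^sub>1), \<dots>, (a\<^sub>d,b\<^sub>d)]\<close> is modelled by coordinates with respect to the
  orthonormal basis of tensor products of matrix units: a tensor is a function on multi-indices
  \<open>[(i\<^sub>1,j\<^sub>1), \<dots>, (i\<^sub>d,j\<^sub>d)]\<close>, and it lies in the tensor product iff it vanishes outside
  \<open>multi_indices ds\<close>. All indices start at 0.
\<close>

type_synonym tensor = "(nat \<times> nat) list \<Rightarrow> complex"

definition multi_indices :: "(nat \<times> nat) list \<Rightarrow> (nat \<times> nat) list set" where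
  "multi_indices ds = listset (map (\<lambda>(a, b). {..<a} \<times> {..<b}) ds)"

definition tensor_space :: "(nat \<times> nat) list \<Rightarrow> tensor set" where
  "tensor_space ds = {T. \<forall>x. x \<notin> multi_indices ds \<longrightarrow> T x = 0}"

definition format :: "complex mat list \<Rightarrow> (nat \<times> nat) list" where
  "format As = map (\<lambda>A. (dim_row A, dim_col A)) As"

definition pure_tensor :: "complex mat list \<Rightarrow> tensor" where
  "pure_tensor As = (\<lambda>x. if x \<in> multi_indices (format As)
     then \<Prod>e<length As. (As ! e) $$ (x ! e) else 0)"

definition pure_tensors :: "(nat \<times> nat) list \<Rightarrow> tensor set" where
  "pure_tensors ds = {pure_tensor As | As. format As = ds}"

definition tensor_inner :: "(nat \<times> nat) list \<Rightarrow> tensor \<Rightarrow> tensor \<Rightarrow> complex" where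
  "tensor_inner ds T U = (\<Sum>x\<in>multi_indices ds. T x * cnj (U x))"

definition tensor_norm :: "(nat \<times> nat) list \<Rightarrow> tensor \<Rightarrow> real" where
  "tensor_norm ds T = sqrt (Re (tensor_inner ds T T))"

definition matrix_inner :: "complex mat \<Rightarrow> complex mat \<Rightarrow> complex" where
  "matrix_inner A B = (let C = A * mat_adjoint B in \<Sum>i<dim_row C. C $$ (i, i))"

lemma matrix_inner_altdef:
  assumes "dim_row A = dim_row B" "dim_col A = dim_col B"
  shows "matrix_inner A B =
    (\<Sum>x\<in>{..<dim_row A} \<times> {..<dim_col A}. A $$ x * cnj (B $$ x))"
  using assms
  by (simp add: matrix_inner_def mat_adjoint_def scalar_prod_def mat_of_rows_def
      atLeast0LessThan sum.cartesian_product case_prod_unfold)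

text \<open>
  \<open>tensor_inner\<close> is the Hermitian form induced by trace(A B*) on the factors.
\<close>

lemma tensor_inner_pure:
  assumes "format As = ds" "format Bs = ds"
  shows "tensor_inner ds (pure_tensor As) (pure_tensor Bs) =
    (\<Prod>e<length ds. matrix_inner (As ! e) (Bs ! e))"
  using assms
proof (induction ds arbitrary: As Bs)
  case Nil
  then show ?case
    by (simp add: tensor_inner_def pure_tensor_def multi_indices_def format_def)
next
  case (Cons d ds)
  obtain A As' where As: "As = A # As'" "d = (dim_row A, dim_col A)" "format As' = ds"
    using Cons.prems(1) by (cases As) (auto simp: format_def)
  obtain B Bs' where Bs: "Bs = B # Bs'" "d = (dim_row B, dim_col B)" "format Bs' = ds"
    using Cons.prems(2) by (cases Bs) (auto simp: format_def)
  let ?I = "{..<dim_row A} \<times> {..<dim_col A}" and ?L = "multi_indices ds"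
  have mi: "multi_indices (d # ds) = (\<lambda>(x, xs). x # xs) ` (?I \<times> ?L)"
    by (auto simp: multi_indices_def set_Cons_def As(2))
  have inj: "inj_on (\<lambda>(x, xs). x # xs) (?I \<times> ?L)"
    by (auto simp: inj_on_def)
  have pure: "pure_tensor (A # As') (x # xs) = A $$ x * pure_tensor As' xs"
    if "x \<in> {..<dim_row A} \<times> {..<dim_col A}" for A x As' xs
    using that
    by (auto simp: pure_tensor_def format_def multi_indices_def set_Cons_def
        prod.lessThan_Suc_shift simp del: prod.lessThan_Suc)
  have "tensor_inner (d # ds) (pure_tensor As) (pure_tensor Bs) =
    (\<Sum>(x, xs)\<in>?I \<times> ?L. pure_tensor (A # As') (x # xs) * cnj (pure_tensor (B # Bs') (x # xs)))"
    unfolding tensor_inner_def mi As(1) Bs(1)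
    by (subst sum.reindex[OF inj]) (simp add: case_prod_unfold)
  also have "\<dots> = (\<Sum>(x, xs)\<in>?I \<times> ?L.
      (A $$ x * cnj (B $$ x)) * (pure_tensor As' xs * cnj (pure_tensor Bs' xs)))"
    using As(2) Bs(2) by (intro sum.cong refl) (auto simp: pure)
  also have "\<dots> = (\<Sum>x\<in>?I. A $$ x * cnj (B $$ x)) * tensor_inner ds (pure_tensor As') (pure_tensor Bs')"
    by (simp add: sum_product sum.cartesian_product tensor_inner_def)
  also have "\<dots> = matrix_inner A B * (\<Prod>e<length ds. matrix_inner (As' ! e) (Bs' ! e))"
    using As(2) Bs(2) by (simp add: Cons.IH[OF As(3) Bs(3)] matrix_inner_altdef)
  finally show ?case
    by (simp add: As(1) Bs(1) prod.lessThan_Suc_shift del: prod.lessThan_Suc)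
qed

text \<open>
  The supremum below is a maximum whenever all the formats are nonzero, since the pure tensors of
  unit length then form a nonempty compact set.
\<close>

definition bracket :: "(nat \<times> nat) list \<Rightarrow> real \<Rightarrow> tensor list \<Rightarrow> real" where
  "bracket ds \<alpha> S = (SUP u \<in> {u \<in> pure_tensors ds. tensor_norm ds u = 1}.
     (\<Sum>i<length S. cmod (tensor_inner ds (S ! i) u) powr \<alpha>) powr (1 / \<alpha>))"

definition t_orthogonal :: "(nat \<times> nat) list \<Rightarrow> real \<Rightarrow> tensor list \<Rightarrow> bool" where
  "t_orthogonal ds t S \<longleftrightarrow>
     (\<forall>s\<in>set S. s \<in> tensor_space ds \<and> tensor_norm ds s = 1) \<and> bracket ds (2 / t) S = 1"

definition diagonal_svd :: "(nat \<times> nat) list \<Rightarrow> tensor \<Rightarrow> real list \<Rightarrow> tensor list \<Rightarrow> bool" where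
  "diagonal_svd ds T \<sigma>s vs \<longleftrightarrow>
     length \<sigma>s = length vs \<and>
     T = (\<lambda>x. \<Sum>i<length vs. complex_of_real (\<sigma>s ! i) * (vs ! i) x) \<and>
     sorted_wrt (\<ge>) \<sigma>s \<and> (\<forall>\<sigma>\<in>set \<sigma>s. \<sigma> > 0) \<and>
     set vs \<subseteq> pure_tensors ds \<and> t_orthogonal ds 2 vs"

definition singular_values :: "(nat \<times> nat) list \<Rightarrow> tensor \<Rightarrow> real list \<Rightarrow> bool" where
  "singular_values ds T \<sigma>s \<longleftrightarrow> (\<exists>vs. diagonal_svd ds T \<sigma>s vs)"

definition matrix_unit :: "nat \<Rightarrow> nat \<Rightarrow> nat \<Rightarrow> nat \<Rightarrow> complex mat" where
  "matrix_unit a b i j = mat a b (\<lambda>x. if x = (i, j) then 1 else 0)"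

definition matmul_format :: "nat \<Rightarrow> nat \<Rightarrow> nat \<Rightarrow> (nat \<times> nat) list" where
  "matmul_format p q r = [(p, q), (q, r), (r, p)]"

definition matmul_summand :: "nat \<Rightarrow> nat \<Rightarrow> nat \<Rightarrow> nat \<Rightarrow> nat \<Rightarrow> nat \<Rightarrow> tensor" where
  "matmul_summand p q r i j k =
     pure_tensor [matrix_unit p q i j, matrix_unit q r j k, matrix_unit r p k i]"

definition matmul_summands :: "nat \<Rightarrow> nat \<Rightarrow> nat \<Rightarrow> tensor list" where
  "matmul_summands p q r =
     [matmul_summand p q r i j k. i \<leftarrow> [0..<p], j \<leftarrow> [0..<q], k \<leftarrow> [0..<r]]"

definition matmul_tensor :: "nat \<Rightarrow> nat \<Rightarrow> nat \<Rightarrow> tensor" where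
  "matmul_tensor p q r = (\<lambda>x. \<Sum>i<p. \<Sum>j<q. \<Sum>k<r. matmul_summand p q r i j k x)"

end

theory Submission
  imports Defs "HOL-Analysis.Convex"
begin

text \<open>
  That the summands are 2-orthogonal amounts to
  \<open>\<Sum> \<bar>a\<^bsub>ij\<^esub> b\<^bsub>jk\<^esub> c\<^bsub>ki\<^esub>\<bar> \<le> \<parallel>a\<parallel> \<parallel>b\<parallel> \<parallel>c\<parallel>\<close>, which is Cauchy--Schwarz applied twice.

  For the singular values, let \<open>T = \<Sum>\<^sub>i v\<^sub>i = \<Sum>\<^sub>j \<sigma>\<^sub>j w\<^sub>j\<close> be two diagonal singular value
  decompositions, the first one having \<open>n\<close> summands. A 2-orthogonal tuple is orthonormal, so
  \<open>\<sigma>\<^sub>j = \<langle>T, w\<^sub>j\<rangle> = \<Sum>\<^sub>i \<langle>v\<^sub>i, w\<^sub>j\<rangle>\<close>. Summing the absolute values over \<open>i\<close> gives \<open>\<sigma>\<^sub>j \<le> 1\<close>, and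
  summing first over \<open>j\<close> gives \<open>\<Sum>\<^sub>j \<sigma>\<^sub>j \<le> n\<close>. As \<open>\<Sum>\<^sub>j \<sigma>\<^sub>j\<^sup>2 = \<langle>T, T\<rangle> = n\<close>, the nonnegative
  terms \<open>\<sigma>\<^sub>j (1 - \<sigma>\<^sub>j)\<close> have a nonpositive sum, whence all \<open>\<sigma>\<^sub>j\<close> are 1.
\<close>

section \<open>The Hermitian form in coordinates\<close>

lemma finite_multi_indices [simp]: "finite (multi_indices ds)"
proof (induction ds)
  case (Cons d ds)
  have "multi_indices (d # ds) =
      (\<lambda>(x, xs). x # xs) ` (({..<fst d} \<times> {..<snd d}) \<times> multi_indices ds)"
    by (auto simp: multi_indices_def set_Cons_def)
  then show ?case
    using Cons.IH by simp
qed (simp add: multi_indices_def)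

lemma tensor_inner_self:
  "tensor_inner ds T T = complex_of_real (\<Sum>x\<in>multi_indices ds. (cmod (T x))\<^sup>2)"
  by (simp add: tensor_inner_def complex_norm_square del: of_real_power)

lemma tensor_norm_sq: "(tensor_norm ds T)\<^sup>2 = (\<Sum>x\<in>multi_indices ds. (cmod (T x))\<^sup>2)"
  by (simp add: tensor_norm_def tensor_inner_self sum_nonneg)

lemma tensor_inner_self_eq_norm_sq: "tensor_inner ds T T = complex_of_real ((tensor_norm ds T)\<^sup>2)"
  by (simp only: tensor_norm_sq tensor_inner_self)

lemma tensor_inner_sum_left:
  "tensor_inner ds (\<lambda>x. \<Sum>i\<in>I. c i * S i x) U = (\<Sum>i\<in>I. c i * tensor_inner ds (S i) U)"
  unfolding tensor_inner_def sum_distrib_right sum_distrib_left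
  by (subst sum.swap) (simp add: mult.assoc)

lemma tensor_inner_sum_right:
  "tensor_inner ds T (\<lambda>x. \<Sum>i\<in>I. c i * S i x) = (\<Sum>i\<in>I. cnj (c i) * tensor_inner ds T (S i))"
  unfolding tensor_inner_def cnj_sum sum_distrib_left
  by (subst sum.swap) (simp add: mult_ac)

lemma tensor_inner_commute: "tensor_inner ds U T = cnj (tensor_inner ds T U)"
  by (simp add: tensor_inner_def mult.commute)

text \<open>Cauchy-Schwarz for unit tensors, by \<open>2ab <= a^2 + b^2\<close> in each coordinate.
  It serves to bound the values under the supremum in \<open>bracket\<close>.\<close>

lemma cmod_tensor_inner_le_one:
  assumes "tensor_norm ds T = 1" "tensor_norm ds U = 1"
  shows "cmod (tensor_inner ds T U) \<le> 1"
proof -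
  have "cmod (tensor_inner ds T U) \<le> (\<Sum>x\<in>multi_indices ds. cmod (T x) * cmod (U x))"
    unfolding tensor_inner_def by (rule order_trans[OF norm_sum]) (simp add: norm_mult)
  also have "\<dots> \<le> (\<Sum>x\<in>multi_indices ds. ((cmod (T x))\<^sup>2 + (cmod (U x))\<^sup>2) / 2)"
  proof (intro sum_mono)
    fix x
    show "cmod (T x) * cmod (U x) \<le> ((cmod (T x))\<^sup>2 + (cmod (U x))\<^sup>2) / 2"
      using sum_squares_bound[of "cmod (T x)" "cmod (U x)"] by simp
  qed
  also have "\<dots> = ((tensor_norm ds T)\<^sup>2 + (tensor_norm ds U)\<^sup>2) / 2"
    by (simp add: tensor_norm_sq sum.distrib flip: sum_divide_distrib)
  finally show ?thesis
    using assms by simp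
qed

section \<open>2-orthogonal tuples\<close>

text \<open>For \<open>t = 2\<close> the exponent \<open>2 / t\<close> is 1, so both powers
  disappear.\<close>

lemma bracket_one:
  "bracket ds 1 S = (SUP u \<in> {u \<in> pure_tensors ds. tensor_norm ds u = 1}.
     \<Sum>i<length S. cmod (tensor_inner ds (S ! i) u))"
  by (simp add: bracket_def sum_nonneg)

text \<open>A value is at most the supremum only if the values are bounded above; here each summand
  is at most 1, so \<open>length S\<close> is a bound.\<close>

lemma t_orthogonal_two_sum_le_one:
  assumes "t_orthogonal ds 2 S" "u \<in> pure_tensors ds" "tensor_norm ds u = 1"
  shows "(\<Sum>i<length S. cmod (tensor_inner ds (S ! i) u)) \<le> 1"
proof -
  have "(\<Sum>i<length S. cmod (tensor_inner ds (S ! i) u)) \<le> (\<Sum>i<length S. 1)"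
    if "tensor_norm ds u = 1" for u
    using assms(1) that
    by (intro sum_mono cmod_tensor_inner_le_one) (auto simp: t_orthogonal_def)
  then have "bdd_above ((\<lambda>u. \<Sum>i<length S. cmod (tensor_inner ds (S ! i) u)) `
      {u \<in> pure_tensors ds. tensor_norm ds u = 1})"
    by (intro bdd_aboveI2) auto
  moreover have "bracket ds 1 S = 1"
    using assms(1) by (simp add: t_orthogonal_def)
  ultimately show ?thesis
    using assms(2,3) cSUP_upper unfolding bracket_one by (metis (mono_tags, lifting) mem_Collect_eq)
qed

text \<open>Each \<open>S ! j\<close> is itself a pure unit tensor, so the tuple may be tested
  against it. The term \<open>k = j\<close> already contributes 1, the whole allowance, so all other
  terms vanish.\<close>

lemma t_orthogonal_two_orthonormal:
  assumes "t_orthogonal ds 2 S" "set S \<subseteq> pure_tensors ds" "i < length S" "j < length S"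
  shows "tensor_inner ds (S ! i) (S ! j) = (if i = j then 1 else 0)"
proof -
  have norm: "tensor_norm ds (S ! j) = 1"
    using assms by (auto simp: t_orthogonal_def)
  have self: "tensor_inner ds (S ! j) (S ! j) = 1"
    by (simp add: tensor_inner_self_eq_norm_sq norm)
  have "(\<Sum>k<length S. cmod (tensor_inner ds (S ! k) (S ! j))) \<le> 1"
    using assms norm by (intro t_orthogonal_two_sum_le_one) auto
  moreover have "(\<Sum>k<length S. cmod (tensor_inner ds (S ! k) (S ! j))) =
      1 + (\<Sum>k\<in>{..<length S} - {j}. cmod (tensor_inner ds (S ! k) (S ! j)))"
    using assms(4) by (subst sum.remove[of _ j]) (auto simp: self)
  moreover have "cmod (tensor_inner ds (S ! i) (S ! j)) \<le>
      (\<Sum>k\<in>{..<length S} - {j}. cmod (tensor_inner ds (S ! k) (S ! j)))" if "i \<noteq> j"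
    using assms(3) that
    by (intro member_le_sum[of i "{..<length S} - {j}" "\<lambda>k. cmod (tensor_inner ds (S ! k) (S ! j))"])
      auto
  ultimately show ?thesis
    using self norm_ge_zero[of "tensor_inner ds (S ! i) (S ! j)"]
    by (cases "i = j") (simp_all flip: norm_le_zero_iff)
qed

section \<open>Uniqueness of singular values when one decomposition has only coefficients 1\<close>

lemma diagonal_svd_inner_nth:
  assumes "diagonal_svd ds T \<sigma>s vs" "j < length vs"
  shows "tensor_inner ds T (vs ! j) = complex_of_real (\<sigma>s ! j)"
proof -
  have "tensor_inner ds T (vs ! j) =
      (\<Sum>i<length vs. complex_of_real (\<sigma>s ! i) * tensor_inner ds (vs ! i) (vs ! j))"
    using assms(1) by (simp add: diagonal_svd_def tensor_inner_sum_left)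
  also have "\<dots> = (\<Sum>i<length vs. if i = j then complex_of_real (\<sigma>s ! j) else 0)"
    using assms by (intro sum.cong) (auto simp: diagonal_svd_def t_orthogonal_two_orthonormal)
  finally show ?thesis
    using assms(2) by simp
qed

lemma diagonal_svd_inner_self:
  assumes "diagonal_svd ds T \<sigma>s vs"
  shows "tensor_inner ds T T = complex_of_real (\<Sum>i<length vs. (\<sigma>s ! i)\<^sup>2)"
proof -
  have T: "T = (\<lambda>x. \<Sum>i<length vs. complex_of_real (\<sigma>s ! i) * (vs ! i) x)"
    using assms by (simp add: diagonal_svd_def)
  have "tensor_inner ds T T =
      (\<Sum>i<length vs. cnj (complex_of_real (\<sigma>s ! i)) * tensor_inner ds T (vs ! i))"
    \<comment> \<open>Only the right argument is expanded; the left \<open>T\<close> is kept for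
      \<open>diagonal_svd_inner_nth\<close>.\<close>
    by (subst (2) T) (rule tensor_inner_sum_right)
  also have "\<dots> = (\<Sum>i<length vs. complex_of_real ((\<sigma>s ! i)\<^sup>2))"
    by (intro sum.cong) (auto simp: diagonal_svd_inner_nth[OF assms] power2_eq_square)
  finally show ?thesis
    by simp
qed

lemma diagonal_svd_unit_unique:
  assumes v: "diagonal_svd ds T (replicate n 1) vs" and w: "diagonal_svd ds T \<sigma>s ws"
  shows "\<sigma>s = replicate n 1"
proof -
  have len: "length vs = n" "length \<sigma>s = length ws"
    using v w by (auto simp: diagonal_svd_def)
  have vs: "t_orthogonal ds 2 vs" "set vs \<subseteq> pure_tensors ds"
    and ws: "t_orthogonal ds 2 ws" "set ws \<subseteq> pure_tensors ds"
    using v w by (auto simp: diagonal_svd_def)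
  have pos: "\<sigma>s ! j > 0" if "j < length ws" for j
    using w that by (auto simp: diagonal_svd_def)
  \<comment> \<open>The factor 1 gives the summands the shape required by
    \<open>tensor_inner_sum_left\<close>.\<close>
  have T: "T = (\<lambda>x. \<Sum>i<n. 1 * (vs ! i) x)"
    using v len by (simp add: diagonal_svd_def)
  have bound: "\<sigma>s ! j \<le> (\<Sum>i<n. cmod (tensor_inner ds (vs ! i) (ws ! j)))" if "j < length ws" for j
  proof -
    have "complex_of_real (\<sigma>s ! j) = tensor_inner ds (\<lambda>x. \<Sum>i<n. 1 * (vs ! i) x) (ws ! j)"
      using diagonal_svd_inner_nth[OF w that] unfolding T by simp
    also have "\<dots> = (\<Sum>i<n. tensor_inner ds (vs ! i) (ws ! j))"
      by (subst tensor_inner_sum_left) simp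
    finally have "cmod (complex_of_real (\<sigma>s ! j)) = cmod (\<Sum>i<n. tensor_inner ds (vs ! i) (ws ! j))"
      by simp
    then have "\<sigma>s ! j = cmod (\<Sum>i<n. tensor_inner ds (vs ! i) (ws ! j))"
      using pos[OF that] by simp
    then show ?thesis
      using norm_sum by metis
  qed
  have le1: "\<sigma>s ! j \<le> 1" if "j < length ws" for j
    using bound[OF that] t_orthogonal_two_sum_le_one[OF vs(1), of "ws ! j"] ws that len(1)
    by (fastforce simp: t_orthogonal_def subset_iff)
  have "(\<Sum>j<length ws. \<sigma>s ! j) \<le>
      (\<Sum>j<length ws. \<Sum>i<n. cmod (tensor_inner ds (vs ! i) (ws ! j)))"
    by (intro sum_mono bound) simp
  \<comment> \<open>Conjugate symmetry exchanges the roles: \<open>ws\<close> becomes the tuple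
    being tested and \<open>vs ! i\<close> the pure unit tensor.\<close>
  also have "\<dots> = (\<Sum>i<n. \<Sum>j<length ws. cmod (tensor_inner ds (ws ! j) (vs ! i)))"
    by (subst sum.swap, subst tensor_inner_commute) simp
  also have "\<dots> \<le> (\<Sum>i<n. 1)"
    using vs len(1) by (intro sum_mono t_orthogonal_two_sum_le_one ws(1)) (auto simp: t_orthogonal_def)
  finally have sum_le: "(\<Sum>j<length ws. \<sigma>s ! j) \<le> real n"
    by simp
  have "complex_of_real (\<Sum>j<length ws. (\<sigma>s ! j)\<^sup>2) = complex_of_real (\<Sum>i<n. (replicate n 1 ! i)\<^sup>2)"
    using diagonal_svd_inner_self[OF v] diagonal_svd_inner_self[OF w] len by simp
  then have sum_sq: "(\<Sum>j<length ws. (\<sigma>s ! j)\<^sup>2) = real n"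
    by (subst (asm) of_real_eq_iff) simp
  have nonneg: "0 \<le> \<sigma>s ! j * (1 - \<sigma>s ! j)" if "j < length ws" for j
    using pos[OF that] le1[OF that] by simp
  have "(\<Sum>j<length ws. \<sigma>s ! j * (1 - \<sigma>s ! j)) \<le> 0"
    using sum_le sum_sq by (simp add: algebra_simps power2_eq_square sum_subtractf)
  then have "(\<Sum>j<length ws. \<sigma>s ! j * (1 - \<sigma>s ! j)) = 0"
    using nonneg by (intro antisym sum_nonneg) auto
  then have "\<forall>j\<in>{..<length ws}. \<sigma>s ! j * (1 - \<sigma>s ! j) = 0"
    using nonneg by (subst (asm) sum_nonneg_eq_0_iff) auto
  then have one: "\<sigma>s ! j = 1" if "j < length ws" for j
    using pos[OF that] that by force
  \<comment> \<open>With all \<open>\<sigma>s ! j\<close> equal to 1, the sum of squares counts the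
    summands.\<close>
  then have "length ws = n"
    using sum_sq by simp
  then show ?thesis
    using one len by (intro nth_equalityI) auto
qed

section \<open>Cauchy-Schwarz for triple products\<close>

text \<open>Cauchy-Schwarz is applied first over the pairs \<open>(i, j)\<close>, then over
  \<open>k\<close> for each fixed pair. The remaining double sum factors, since its \<open>b\<close>
  part depends only on \<open>j\<close> and its \<open>c\<close> part only on
  \<open>i\<close>.\<close>

lemma sum_triple_product_le:
  fixes a :: "'a \<Rightarrow> 'b \<Rightarrow> real" and b :: "'b \<Rightarrow> 'c \<Rightarrow> real" and c :: "'c \<Rightarrow> 'a \<Rightarrow> real"
  shows "(\<Sum>i\<in>I. \<Sum>j\<in>J. \<Sum>k\<in>K. a i j * b j k * c k i)\<^sup>2 \<le>
    (\<Sum>i\<in>I. \<Sum>j\<in>J. (a i j)\<^sup>2) * (\<Sum>j\<in>J. \<Sum>k\<in>K. (b j k)\<^sup>2) * (\<Sum>k\<in>K. \<Sum>i\<in>I. (c k i)\<^sup>2)"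
proof -
  have "(\<Sum>i\<in>I. \<Sum>j\<in>J. \<Sum>k\<in>K. a i j * b j k * c k i)\<^sup>2 =
      (\<Sum>(i, j)\<in>I \<times> J. a i j * (\<Sum>k\<in>K. b j k * c k i))\<^sup>2"
    by (simp add: sum.cartesian_product[symmetric] sum_distrib_left mult.assoc)
  also have "\<dots> \<le> (\<Sum>(i, j)\<in>I \<times> J. (a i j)\<^sup>2) * (\<Sum>(i, j)\<in>I \<times> J. (\<Sum>k\<in>K. b j k * c k i)\<^sup>2)"
    using Cauchy_Schwarz_ineq_sum[of "\<lambda>(i, j). a i j" "\<lambda>(i, j). \<Sum>k\<in>K. b j k * c k i" "I \<times> J"]
    by (simp add: case_prod_unfold)
  also have "\<dots> \<le> (\<Sum>(i, j)\<in>I \<times> J. (a i j)\<^sup>2) *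
      (\<Sum>(i, j)\<in>I \<times> J. (\<Sum>k\<in>K. (b j k)\<^sup>2) * (\<Sum>k\<in>K. (c k i)\<^sup>2))"
    by (intro mult_left_mono sum_mono) (auto intro: Cauchy_Schwarz_ineq_sum sum_nonneg)
  also have "(\<Sum>(i, j)\<in>I \<times> J. (\<Sum>k\<in>K. (b j k)\<^sup>2) * (\<Sum>k\<in>K. (c k i)\<^sup>2)) =
      (\<Sum>j\<in>J. \<Sum>k\<in>K. (b j k)\<^sup>2) * (\<Sum>i\<in>I. \<Sum>k\<in>K. (c k i)\<^sup>2)"
    unfolding sum_product sum.cartesian_product[symmetric] by (rule sum.swap)
  also have "(\<Sum>i\<in>I. \<Sum>k\<in>K. (c k i)\<^sup>2) = (\<Sum>k\<in>K. \<Sum>i\<in>I. (c k i)\<^sup>2)"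
    by (rule sum.swap)
  also have "(\<Sum>(i, j)\<in>I \<times> J. (a i j)\<^sup>2) = (\<Sum>i\<in>I. \<Sum>j\<in>J. (a i j)\<^sup>2)"
    by (simp add: sum.cartesian_product)
  finally show ?thesis
    by (simp add: mult.assoc)
qed

section \<open>The summands of the matrix multiplication tensor\<close>

lemma matrix_unit_simps [simp]:
  "dim_row (matrix_unit a b i j) = a" "dim_col (matrix_unit a b i j) = b"
  "k < a \<Longrightarrow> l < b \<Longrightarrow> matrix_unit a b i j $$ (k, l) = (if k = i \<and> l = j then 1 else 0)"
  by (auto simp: matrix_unit_def)

lemma matrix_inner_unit_left:
  assumes "dim_row A = a" "dim_col A = b" "i < a" "j < b"
  shows "matrix_inner (matrix_unit a b i j) A = cnj (A $$ (i, j))"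
proof -
  have "matrix_inner (matrix_unit a b i j) A =
      (\<Sum>x\<in>{..<a} \<times> {..<b}. if x = (i, j) then cnj (A $$ (i, j)) else 0)"
    using assms by (simp only: matrix_inner_altdef matrix_unit_simps) (intro sum.cong, auto split: if_splits)
  then show ?thesis
    using assms by simp
qed

lemma matrix_inner_self:
  "matrix_inner A A = complex_of_real (\<Sum>i<dim_row A. \<Sum>j<dim_col A. (cmod (A $$ (i, j)))\<^sup>2)"
  by (simp add: matrix_inner_altdef sum.cartesian_product complex_norm_square case_prod_unfold
      del: of_real_power)

lemma tensor_inner_pure_matmul:
  assumes "format [A, B, C] = matmul_format p q r" "format [A', B', C'] = matmul_format p q r"
  shows "tensor_inner (matmul_format p q r) (pure_tensor [A, B, C]) (pure_tensor [A', B', C']) =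
    matrix_inner A A' * matrix_inner B B' * matrix_inner C C'"
  using tensor_inner_pure[OF assms]
  by (simp add: matmul_format_def eval_nat_numeral mult.assoc)

lemma matmul_summand_in_pure_tensors:
  "matmul_summand p q r i j k \<in> pure_tensors (matmul_format p q r)"
proof -
  have "format [matrix_unit p q i j, matrix_unit q r j k, matrix_unit r p k i] = matmul_format p q r"
    by (simp add: format_def matmul_format_def)
  then show ?thesis
    unfolding pure_tensors_def matmul_summand_def by blast
qed

lemma pure_tensors_subset_tensor_space: "pure_tensors ds \<subseteq> tensor_space ds"
  by (auto simp: pure_tensors_def tensor_space_def pure_tensor_def)

lemma pure_tensors_matmulE:
  assumes "u \<in> pure_tensors (matmul_format p q r)"
  obtains A B C where "u = pure_tensor [A, B, C]" "format [A, B, C] = matmul_format p q r"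
  using assms unfolding pure_tensors_def
  by (auto simp: format_def matmul_format_def map_eq_Cons_conv)

lemma tensor_inner_matmul_summand:
  assumes "i < p" "j < q" "k < r" "format [A, B, C] = matmul_format p q r"
  shows "tensor_inner (matmul_format p q r) (matmul_summand p q r i j k) (pure_tensor [A, B, C]) =
    cnj (A $$ (i, j)) * cnj (B $$ (j, k)) * cnj (C $$ (k, i))"
  unfolding matmul_summand_def using assms
  by (subst tensor_inner_pure_matmul)
    (auto simp: format_def matmul_format_def matrix_inner_unit_left)

lemma tensor_inner_matmul_summands:
  assumes "i < p" "j < q" "k < r" "i' < p" "j' < q" "k' < r"
  shows "tensor_inner (matmul_format p q r) (matmul_summand p q r i j k)
      (matmul_summand p q r i' j' k') = (if i = i' \<and> j = j' \<and> k = k' then 1 else 0)"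
  \<comment> \<open>Only the right argument is unfolded, so that the left one still matches
    \<open>tensor_inner_matmul_summand\<close>.\<close>
  unfolding matmul_summand_def[of p q r i'] using assms
  by (subst tensor_inner_matmul_summand) (auto simp: format_def matmul_format_def)

lemma tensor_norm_matmul_summand:
  assumes "i < p" "j < q" "k < r"
  shows "tensor_norm (matmul_format p q r) (matmul_summand p q r i j k) = 1"
  using assms by (simp add: tensor_norm_def tensor_inner_matmul_summands)

text \<open>Turns sums over list positions into triple sums. The codomain is general because
  \<open>f\<close> is real-valued for the bracket, complex-valued for the tensor and constantly 1 in
  \<open>nat\<close> for the length.\<close>

lemma sum_nth_matmul_summands:
  fixes f :: "tensor \<Rightarrow> 'a :: comm_monoid_add"
  shows "(\<Sum>l<length (matmul_summands p q r). f (matmul_summands p q r ! l)) =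
    (\<Sum>i<p. \<Sum>j<q. \<Sum>k<r. f (matmul_summand p q r i j k))"
proof -
  have concat: "sum_list (map f (concat xss)) = sum_list (map (\<lambda>xs. sum_list (map f xs)) xss)" for xss
    by (induction xss) auto
  have "(\<Sum>l<length (matmul_summands p q r). f (matmul_summands p q r ! l)) =
      sum_list (map f (matmul_summands p q r))"
    by (simp add: sum_list_sum_nth atLeast0LessThan)
  also have "\<dots> = (\<Sum>i<p. \<Sum>j<q. \<Sum>k<r. f (matmul_summand p q r i j k))"
    by (simp add: matmul_summands_def concat comp_def interv_sum_list_conv_sum_set_nat
        atLeast0LessThan)
  finally show ?thesis .
qed

lemma length_matmul_summands: "length (matmul_summands p q r) = p * q * r"
  using sum_nth_matmul_summands[of "\<lambda>_. 1 :: nat" p q r] by simp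

lemma set_matmul_summands:
  "set (matmul_summands p q r) = {matmul_summand p q r i j k | i j k. i < p \<and> j < q \<and> k < r}"
  by (fastforce simp: matmul_summands_def)

text \<open>The squared norm of a pure tensor is the product of the squared Frobenius norms of its
  factors, so for a unit tensor \<open>u\<close> the right-hand side of
  \<open>sum_triple_product_le\<close> is 1.\<close>

lemma matmul_summands_bound:
  assumes "u \<in> pure_tensors (matmul_format p q r)" "tensor_norm (matmul_format p q r) u = 1"
  shows "(\<Sum>i<p. \<Sum>j<q. \<Sum>k<r.
      cmod (tensor_inner (matmul_format p q r) (matmul_summand p q r i j k) u)) \<le> 1"
proof -
  obtain A B C where u: "u = pure_tensor [A, B, C]" and f: "format [A, B, C] = matmul_format p q r"
    using assms(1) by (rule pure_tensors_matmulE)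
  have dims: "dim_row A = p" "dim_col A = q" "dim_row B = q" "dim_col B = r"
      "dim_row C = r" "dim_col C = p"
    using f by (auto simp: format_def matmul_format_def)
  let ?a = "\<lambda>i j. cmod (A $$ (i, j))" and ?b = "\<lambda>j k. cmod (B $$ (j, k))"
    and ?c = "\<lambda>k i. cmod (C $$ (k, i))"
  have "complex_of_real ((\<Sum>i<p. \<Sum>j<q. (?a i j)\<^sup>2) * (\<Sum>j<q. \<Sum>k<r. (?b j k)\<^sup>2) *
      (\<Sum>k<r. \<Sum>i<p. (?c k i)\<^sup>2)) = tensor_inner (matmul_format p q r) u u"
    unfolding u tensor_inner_pure_matmul[OF f f] matrix_inner_self dims by simp
  also have "\<dots> = complex_of_real 1"
    by (simp add: tensor_inner_self_eq_norm_sq assms(2))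
  finally have norms: "(\<Sum>i<p. \<Sum>j<q. (?a i j)\<^sup>2) * (\<Sum>j<q. \<Sum>k<r. (?b j k)\<^sup>2) *
      (\<Sum>k<r. \<Sum>i<p. (?c k i)\<^sup>2) = 1"
    by (subst (asm) of_real_eq_iff)
  have "(\<Sum>i<p. \<Sum>j<q. \<Sum>k<r. ?a i j * ?b j k * ?c k i)\<^sup>2 \<le> 1\<^sup>2"
    using sum_triple_product_le[of ?a ?b ?c "{..<r}" "{..<q}" "{..<p}"] unfolding norms by simp
  then have "(\<Sum>i<p. \<Sum>j<q. \<Sum>k<r. ?a i j * ?b j k * ?c k i) \<le> 1"
    by (rule power2_le_imp_le) simp
  then show ?thesis
    by (simp add: u tensor_inner_matmul_summand[OF _ _ _ f] norm_mult)
qed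

section \<open>The diagonal singular value decomposition\<close>

lemma t_orthogonal_matmul_summands:
  assumes "p \<ge> 1" "q \<ge> 1" "r \<ge> 1"
  shows "t_orthogonal (matmul_format p q r) 2 (matmul_summands p q r)"
proof -
  let ?ds = "matmul_format p q r" and ?v = "matmul_summand p q r"
  let ?U = "{u \<in> pure_tensors ?ds. tensor_norm ?ds u = 1}"
  let ?f = "\<lambda>u. \<Sum>i<p. \<Sum>j<q. \<Sum>k<r. cmod (tensor_inner ?ds (?v i j k) u)"
  have bracket: "bracket ?ds 1 (matmul_summands p q r) = (SUP u \<in> ?U. ?f u)"
    unfolding bracket_one by (subst sum_nth_matmul_summands) (rule refl)
  have le: "?f u \<le> 1" if "u \<in> ?U" for u
    using that matmul_summands_bound by blast
  \<comment> \<open>Any summand attains the maximum 1; the one at index 0 exists as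
    \<open>p\<close>, \<open>q\<close> and \<open>r\<close> are positive.\<close>
  have mem: "?v 0 0 0 \<in> ?U"
    using assms by (simp add: matmul_summand_in_pure_tensors tensor_norm_matmul_summand)
  have "1 = cmod (tensor_inner ?ds (?v 0 0 0) (?v 0 0 0))"
    using assms by (simp add: tensor_inner_matmul_summands)
  \<comment> \<open>The nested sums are built up one at a time from the inside, adding nonnegative
    terms.\<close>
  also have "\<dots> \<le> (\<Sum>k<r. cmod (tensor_inner ?ds (?v 0 0 k) (?v 0 0 0)))"
    using assms by (intro member_le_sum) auto
  also have "\<dots> \<le> (\<Sum>j<q. \<Sum>k<r. cmod (tensor_inner ?ds (?v 0 j k) (?v 0 0 0)))"
    using assms by (intro member_le_sum[where i = 0]) (auto intro!: sum_nonneg)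
  also have "\<dots> \<le> ?f (?v 0 0 0)"
    using assms by (intro member_le_sum[where i = 0]) (auto intro!: sum_nonneg)
  finally have ge: "1 \<le> ?f (?v 0 0 0)" .
  have "(SUP u \<in> ?U. ?f u) = 1"
  proof (rule antisym)
    show "(SUP u \<in> ?U. ?f u) \<le> 1"
      using mem le by (intro cSUP_least) blast+
    show "1 \<le> (SUP u \<in> ?U. ?f u)"
      using mem le ge by (intro cSUP_upper2[of _ _ "?v 0 0 0"] bdd_aboveI2[of _ _ 1]) blast+
  qed
  moreover have "s \<in> tensor_space ?ds \<and> tensor_norm ?ds s = 1"
    if "s \<in> set (matmul_summands p q r)" for s
    using that pure_tensors_subset_tensor_space matmul_summand_in_pure_tensors
    by (fastforce simp: set_matmul_summands tensor_norm_matmul_summand)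
  ultimately show ?thesis
    by (simp add: t_orthogonal_def bracket)
qed

lemma diagonal_svd_matmul:
  assumes "p \<ge> 1" "q \<ge> 1" "r \<ge> 1"
  shows "diagonal_svd (matmul_format p q r) (matmul_tensor p q r)
    (replicate (p * q * r) 1) (matmul_summands p q r)"
proof -
  have "matmul_tensor p q r =
      (\<lambda>x. \<Sum>l<length (matmul_summands p q r). (matmul_summands p q r ! l) x)"
    unfolding matmul_tensor_def by (subst sum_nth_matmul_summands) (rule refl)
  moreover have "set (matmul_summands p q r) \<subseteq> pure_tensors (matmul_format p q r)"
    by (auto simp: set_matmul_summands matmul_summand_in_pure_tensors)
  ultimately show ?thesis
    using t_orthogonal_matmul_summands[OF assms]
    by (simp add: diagonal_svd_def length_matmul_summands sorted_wrt_iff_nth_less)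
qed

theorem theorem1p9:
  fixes p q r :: nat
  assumes "p \<ge> 1" and "q \<ge> 1" and "r \<ge> 1"
  shows "diagonal_svd (matmul_format p q r) (matmul_tensor p q r)
           (replicate (p * q * r) 1) (matmul_summands p q r)
       \<and> (\<forall>\<sigma>s. singular_values (matmul_format p q r) (matmul_tensor p q r) \<sigma>s
            \<longleftrightarrow> \<sigma>s = replicate (p * q * r) 1)"
  using diagonal_svd_matmul[OF assms] diagonal_svd_unit_unique
  unfolding singular_values_def by blast

end
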